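(* Let $\mathcal{E}_1,\mathcal{E}$ be finite dimensional Hilbert spaces, $h:\mathcal{E}_1\to(-\infty,\infty]$ a proper closed convex function, $G:\mathcal{E}_1\to\mathcal{E}$ a linear map and $b\in G\operatorname{dom}h$. Let $H(x)=h(x)+\delta_{\{b\}}(Gx)$ and suppose that $\operatorname{Argmin}H\ne\emptyset$. Let $\bar\lambda\in\mathcal{E}$ be a Lagrange multiplier for the problem $$\min_{x\in\mathcal{E}_1}\ h(x)\quad\text{s.t.}\quad Gx=b.$$ Suppose that $H_{\bar\lambda}(x):=h(x)+\langle\bar\lambda,Gx-b\rangle$ satisfies the KL property with exponent $\alpha\in[0,1)$ at an $\bar x\in\operatorname{Argmin}H$. If $\mathrm{ri}(\operatorname{Argmin}H_{\bar\lambda})\cap G^{-1}\{b\}\ne\emptyset$ or $\operatorname{Argmin}H_{\bar\lambda}$ is a polyhedron, then $H$ also satisfies the KL property at $\bar x$ with exponent $\alpha$.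
   Context: $\delta_{\{b\}}$ is the indicator function of $\{b\}$ ($0$ at $b$, $\infty$ elsewhere); $\operatorname{dom}$ is the effective domain; $\mathrm{ri}$ the relative interior; $\operatorname{Argmin}$ the set of minimizers; $\operatorname{dist}(x,C)=\inf_{y\in C}\|x-y\|$; $\partial$ the convex subdifferential. Lagrange multiplier (in the sense of Rockafellar's Kuhn–Tucker vectors): $\bar\lambda\in\mathcal{E}$ such that $\inf_{x\in\mathcal{E}_1}\{h(x)+\langle\bar\lambda,Gx-b\rangle\}$ is finite and equals the optimal value $\inf\{h(x):Gx=b\}$. A proper closed convex function $\psi$ satisfies the KL property with exponent $\alpha\in[0,1)$ at $\bar x\in\operatorname{dom}\partial\psi=\{x:\partial\psi(x)\ne\emptyset\}$ if there exist $r\in(0,\infty]$, $\rho>0$ and a neighborhood $U$ of $\bar x$ such that, with $\phi(s)=\rho s^{1-\alpha}$ on $[0,r)$, one has $\phi'(\psi(x)-\psi(\bar x))\operatorname{dist}(0,\partial\psi(x))\ge1$ for all $x\in U$ with $\psi(\bar x)<\psi(x)<\psi(\bar x)+r$ (with $\operatorname{dist}(0,\emptyset)=\infty$). *)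

theory Defs
  imports "HOL-Analysis.Analysis"
begin

text \<open>
  Functions with values in \<open>(-\<infinity>, \<infinity>]\<close> are rendered as \<^typ>\<open>ereal\<close>-valued functions;
  the value \<open>-\<infinity>\<close> is excluded by \<open>proper_fun\<close>.
\<close>

definition eff_dom :: "('a \<Rightarrow> ereal) \<Rightarrow> 'a set" where
  "eff_dom f = {x. f x < \<infinity>}"

definition proper_fun :: "('a \<Rightarrow> ereal) \<Rightarrow> bool" where
  "proper_fun f \<longleftrightarrow> (\<forall>x. f x \<noteq> -\<infinity>) \<and> eff_dom f \<noteq> {}"

text \<open>The library constant \<open>epigraph\<close> is restricted to real-valued functions.\<close>

definition epi :: "('a \<Rightarrow> ereal) \<Rightarrow> ('a \<times> real) set" where
  "epi f = {(x, r). f x \<le> ereal r}"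

definition convex_fun :: "('a::real_vector \<Rightarrow> ereal) \<Rightarrow> bool" where
  "convex_fun f \<longleftrightarrow> convex (epi f)"

text \<open>For proper functions, closedness is the same as lower semicontinuity.\<close>

definition closed_fun :: "('a::topological_space \<Rightarrow> ereal) \<Rightarrow> bool" where
  "closed_fun f \<longleftrightarrow> closed (epi f)"

definition indicator_fun :: "'a set \<Rightarrow> 'a \<Rightarrow> ereal" where
  "indicator_fun C x = (if x \<in> C then 0 else \<infinity>)"

definition Argmin :: "('a \<Rightarrow> ereal) \<Rightarrow> 'a set" where
  "Argmin f = {x. \<forall>y. f x \<le> f y}"

text \<open>For proper \<open>f\<close> the subdifferential is empty at points outside the effective domain.\<close>

definition subdifferential :: "('a::real_inner \<Rightarrow> ereal) \<Rightarrow> 'a \<Rightarrow> 'a set" where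
  "subdifferential f x = {v. \<forall>y. f x + ereal (v \<bullet> (y - x)) \<le> f y}"

definition dom_subdifferential :: "('a::real_inner \<Rightarrow> ereal) \<Rightarrow> 'a set" where
  "dom_subdifferential f = {x. subdifferential f x \<noteq> {}}"

text \<open>Unlike \<open>infdist\<close>, the distance to the empty set is \<open>\<infinity>\<close> here.\<close>

definition edist_set :: "'a::metric_space \<Rightarrow> 'a set \<Rightarrow> ereal" where
  "edist_set x C = (INF y\<in>C. ereal (dist x y))"

text \<open>
  The derivative of \<open>\<phi>(s) = \<rho> s\<^sup>1\<^sup>-\<^sup>\<alpha>\<close> is only taken at arguments in the open interval
  \<open>(0, r)\<close>, so the values of \<open>powr\<close> at nonpositive arguments play no role.
  The argument \<open>\<psi> x - \<psi> xb\<close> of \<open>real_of_ereal\<close> is finite for proper \<open>\<psi>\<close>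
  under the stated constraints on \<open>x\<close>.
\<close>

definition KL_property :: "('a::real_inner \<Rightarrow> ereal) \<Rightarrow> real \<Rightarrow> 'a \<Rightarrow> bool" where
  "KL_property \<psi> \<alpha> xb \<longleftrightarrow>
     xb \<in> dom_subdifferential \<psi> \<and>
     (\<exists>r::ereal. \<exists>\<rho>::real. \<exists>U. 0 < r \<and> 0 < \<rho> \<and> open U \<and> xb \<in> U \<and>
        (\<forall>x\<in>U. \<psi> xb < \<psi> x \<and> \<psi> x < \<psi> xb + r \<longrightarrow>
           ereal (deriv (\<lambda>s. \<rho> * s powr (1 - \<alpha>)) (real_of_ereal (\<psi> x - \<psi> xb)))
             * edist_set 0 (subdifferential \<psi> x) \<ge> 1))"

definition constrained_obj ::
  "('a \<Rightarrow> ereal) \<Rightarrow> ('a \<Rightarrow> 'b) \<Rightarrow> 'b \<Rightarrow> 'a \<Rightarrow> ereal" where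
  "constrained_obj h G b x = h x + indicator_fun {b} (G x)"

definition lagrangian ::
  "('a \<Rightarrow> ereal) \<Rightarrow> ('a \<Rightarrow> 'b::real_inner) \<Rightarrow> 'b \<Rightarrow> 'b \<Rightarrow> 'a \<Rightarrow> ereal" where
  "lagrangian h G b l x = h x + ereal (l \<bullet> (G x - b))"

definition lagrange_multiplier ::
  "('a \<Rightarrow> ereal) \<Rightarrow> ('a \<Rightarrow> 'b::real_inner) \<Rightarrow> 'b \<Rightarrow> 'b \<Rightarrow> bool" where
  "lagrange_multiplier h G b l \<longleftrightarrow>
     \<bar>INF x. lagrangian h G b l x\<bar> \<noteq> \<infinity> \<and>
     (INF x. lagrangian h G b l x) = (INF x\<in>{x. G x = b}. h x)"

end

theory Submission
  imports Defs
begin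

text \<open>
  For a convex function, the KL property with exponent \<open>\<alpha>\<close> at a minimizer is equivalent to a
  local error bound: the distance to the set of minimizers is at most a constant times the
  \<open>(1 - \<alpha>)\<close>-th power of the gap to the minimum. On \<open>G\<^sup>-\<^sup>1{b}\<close> the Lagrangian coincides with the
  constrained objective and has the same minimum, so its error bound controls the distance from
  feasible points to the minimizers of the Lagrangian. Either alternative of the last hypothesis
  makes this set and the affine space \<open>G\<^sup>-\<^sup>1{b}\<close> linearly regular, so the same bound, up to a
  constant, holds for the distance to their intersection, which consists of the minimizers of
  the constrained problem.
\<close>

section \<open>Linear regularity\<close>

text \<open>A local Hoffman bound. It serves a polyhedral set of minimizers directly and, with
  \<open>T\<close> an affine hull, also the relative interior case. Keeping \<open>x\<close> within
  distance 1 of \<open>z\<close> lets a polytope with finitely many generators do the work.\<close>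

lemma polyhedra_linearly_regular:
  fixes A T :: "'a::euclidean_space set"
  assumes A: "polyhedron A" and T: "polyhedron T" and z: "z \<in> A" "z \<in> T"
  obtains \<kappa> where "\<kappa> > 0"
    "\<And>x y. \<lbrakk>x \<in> A; y \<in> T; dist x z \<le> 1\<rbrakk> \<Longrightarrow> \<exists>q\<in>A \<inter> T. dist x q \<le> \<kappa> * dist x y"
proof -
  obtain F where F: "finite F" "T = \<Inter>F" and "\<forall>h\<in>F. \<exists>a b. a \<noteq> 0 \<and> h = {x. a \<bullet> x \<le> b}"
    using T unfolding polyhedron_def by auto
  then obtain a b where ab: "\<And>h. h \<in> F \<Longrightarrow> h = {x. a h \<bullet> x \<le> b h}"
    by metis
  have T_iff: "x \<in> T \<longleftrightarrow> (\<forall>h\<in>F. a h \<bullet> x \<le> b h)" for x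
    using F(2) ab by blast
  txt \<open>
    \<open>Q\<close> is the epigraph of the violation of the constraints of \<open>T\<close> over \<open>A\<close>, cut off to a
    polytope. A point of \<open>Q\<close> is moved into \<open>A \<inter> T\<close> by replacing, in its representation by
    generators, all those of positive height by \<open>z\<close>; their total weight is at most a multiple
    of the height.
  \<close>
  define Q :: "('a \<times> real) set" where
    "Q = ((A \<inter> cbox (z - One) (z + One)) \<times> cbox 0 1) \<inter>
         (\<Inter>h\<in>F. {p. (a h, - norm (a h)) \<bullet> p \<le> b h})"
  have Q_iff: "(x, t) \<in> Q \<longleftrightarrow> x \<in> A \<and> x \<in> cbox (z - One) (z + One) \<and> 0 \<le> t \<and> t \<le> 1 \<and>
      (\<forall>h\<in>F. a h \<bullet> x - norm (a h) * t \<le> b h)" for x t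
    by (auto simp: Q_def)
  have "polytope Q"
    unfolding Q_def
    by (intro polytope_Int_polyhedron polytope_Times polyhedron_Int_polytope polytope_interval A
        polyhedron_Inter finite_imageI F(1)) (auto simp: polyhedron_halfspace_le)
  then obtain V where V: "finite V" "Q = convex hull V"
    unfolding polytope_def by blast
  have VQ: "v \<in> Q" if "v \<in> V" for v
    using that V(2) hull_subset[of V convex] by blast
  \<comment> \<open>A positive lower bound for the positive heights of generators; the inserted 1
    keeps the minimum defined when all heights are 0.\<close>
  define \<gamma> where "\<gamma> = Min (insert 1 (snd ` {v\<in>V. snd v > 0}))"
  have \<gamma>: "\<gamma> > 0" "\<And>v. v \<in> V \<Longrightarrow> snd v > 0 \<Longrightarrow> \<gamma> \<le> snd v"
    unfolding \<gamma>_def using V(1) by (auto intro!: Min_le)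
  obtain R where R: "R > 0" "\<And>v. v \<in> V \<Longrightarrow> norm (fst v - z) \<le> R"
  proof -
    have "bounded ((\<lambda>v. fst v - z) ` V)"
      using V(1) by (simp add: finite_imp_bounded)
    then show ?thesis
      using that unfolding bounded_pos by auto
  qed
  define f where "f v = (if snd v > 0 then z else fst v)" for v :: "'a \<times> real"
  have snd0: "0 \<le> snd v" if "v \<in> V" for v
    using VQ[OF that] Q_iff[of "fst v" "snd v"] by simp
  have f: "f v \<in> A \<inter> T" if "v \<in> V" for v
  proof (cases "snd v > 0")
    case False
    then have "snd v = 0"
      using snd0[OF that] by simp
    then have "(fst v, 0) \<in> Q"
      using VQ[OF that] by (metis prod.collapse)
    then show ?thesis
      using False by (simp add: Q_iff T_iff f_def)
  qed (use z in \<open>simp add: f_def\<close>)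
  have fbound: "norm (fst v - f v) \<le> R / \<gamma> * snd v" if v: "v \<in> V" for v
  proof (cases "snd v > 0")
    case True
    then have "R \<le> R / \<gamma> * snd v"
      using \<gamma>(1) \<gamma>(2)[OF v True] R(1) by (simp add: field_simps)
    then show ?thesis
      using R(2)[OF v] True by (simp add: f_def)
  qed (use snd0[OF v] in \<open>simp add: f_def\<close>)
  have "\<exists>q\<in>A \<inter> T. dist x q \<le> (R / \<gamma> + 1) * dist x y"
    if x: "x \<in> A" "dist x z \<le> 1" and y: "y \<in> T" for x y
  \<comment> \<open>If \<open>y\<close> is farther than 1 from \<open>x\<close>, then
    \<open>z\<close> itself serves, by the summand 1 in the constant. Otherwise the distance is an
    admissible height in \<open>Q\<close>.\<close>
  proof (cases "dist x y \<le> 1")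
    case False
    then have "dist x z \<le> 1 * dist x y"
      using x(2) by simp
    also have "\<dots> \<le> (R / \<gamma> + 1) * dist x y"
      using R(1) \<gamma>(1) by (intro mult_right_mono) auto
    finally show ?thesis
      using z by blast
  next
    case True
    define t where "t = dist x y"
    have "x \<in> cbox (z - One) (z + One)"
    proof -
      have "\<bar>(x - z) \<bullet> i\<bar> \<le> 1" if "i \<in> Basis" for i
        using Basis_le_norm[OF that, of "x - z"] x(2) by (simp add: dist_norm)
      then show ?thesis
        by (auto simp: mem_box inner_diff_left inner_add_left abs_le_iff algebra_simps)
    qed
    \<comment> \<open>Passing from \<open>y\<close> to \<open>x\<close> raises the left side of a
      constraint by at most \<open>norm (a h) * t\<close>, exactly the slack built into
      \<open>Q\<close>.\<close>
    moreover have "a h \<bullet> x - norm (a h) * t \<le> b h" if "h \<in> F" for h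
    proof -
      have "a h \<bullet> (x - y) \<le> norm (a h) * t"
        unfolding t_def dist_norm by (rule norm_cauchy_schwarz)
      then show ?thesis
        using y T_iff that by (fastforce simp: inner_diff_right)
    qed
    ultimately have "(x, t) \<in> Q"
      using x True by (simp add: Q_iff t_def)
    then obtain u where u: "\<And>v. v \<in> V \<Longrightarrow> 0 \<le> u v" "sum u V = 1"
      and uV: "(\<Sum>v\<in>V. u v *\<^sub>R v) = (x, t)"
      unfolding V(2) convex_hull_finite[OF V(1)] by blast
    define q where "q = (\<Sum>v\<in>V. u v *\<^sub>R f v)"
    have "q \<in> A \<inter> T"
      unfolding q_def
      by (intro convex_sum V(1) u f convex_Int polyhedron_imp_convex A T)
    moreover have "dist x q \<le> (R / \<gamma> + 1) * t"
    proof -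
      have xs: "x = (\<Sum>v\<in>V. u v *\<^sub>R fst v)" "t = (\<Sum>v\<in>V. u v * snd v)"
        using arg_cong[OF uV, of fst] arg_cong[OF uV, of snd]
        by (simp_all add: fst_sum snd_sum)
      have "dist x q = norm (\<Sum>v\<in>V. u v *\<^sub>R (fst v - f v))"
        by (simp add: dist_norm xs(1) q_def scaleR_diff_right sum_subtractf)
      also have "\<dots> \<le> (\<Sum>v\<in>V. u v * (R / \<gamma> * snd v))"
        by (rule sum_norm_le) (simp only: norm_scaleR abs_of_nonneg u(1) mult_left_mono fbound)
      also have "\<dots> = R / \<gamma> * t"
        by (simp add: xs(2) sum_distrib_left mult_ac)
      also have "\<dots> \<le> (R / \<gamma> + 1) * t"
        by (simp add: t_def algebra_simps)
      finally show ?thesis .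
    qed
    ultimately show ?thesis
      unfolding t_def by blast
  qed
  moreover have "R / \<gamma> + 1 > 0"
    using R(1) \<gamma>(1) by (simp add: add_pos_pos)
  ultimately show ?thesis
    using that by blast
qed

text \<open>The polyhedral bound gives \<open>q\<close> in \<open>A\<close> and in the affine hull
  of \<open>S\<close>, close to \<open>x\<close> and hence to \<open>y\<close>. It may miss
  \<open>S\<close>, but moving it toward \<open>w\<close> by a fraction of order
  \<open>dist x y\<close> brings it into \<open>S\<close>: a ball around \<open>w\<close> in the
  affine hull absorbs the error \<open>q - y\<close>. The move stays in \<open>A\<close>.\<close>

lemma rel_interior_linearly_regular:
  fixes S A :: "'a::euclidean_space set"
  assumes S: "convex S" and A: "affine A" and w: "w \<in> rel_interior S" "w \<in> A"
    and z: "z \<in> S" "z \<in> A"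
  obtains \<kappa> where "\<kappa> > 0"
    "\<And>x y. \<lbrakk>x \<in> A; y \<in> S; dist x z \<le> 1\<rbrakk> \<Longrightarrow> \<exists>q\<in>A \<inter> S. dist x q \<le> \<kappa> * dist x y"
proof -
  let ?T = "affine hull S"
  have ST: "S \<subseteq> ?T"
    by (rule hull_subset)
  obtain \<kappa> where \<kappa>: "\<kappa> > 0"
    "\<And>x y. \<lbrakk>x \<in> A; y \<in> ?T; dist x z \<le> 1\<rbrakk> \<Longrightarrow> \<exists>q\<in>A \<inter> ?T. dist x q \<le> \<kappa> * dist x y"
    using polyhedra_linearly_regular[of A ?T z] A z ST
    by (metis affine_imp_polyhedron polyhedron_affine_hull subsetD)
  obtain \<epsilon> where \<epsilon>: "\<epsilon> > 0" "cball w \<epsilon> \<inter> ?T \<subseteq> S" and wS: "w \<in> S"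
    using w(1) by (auto simp: mem_rel_interior_cball)
  \<comment> \<open>\<open>R\<close> bounds the distance from \<open>w\<close> to \<open>q\<close>
    by way of \<open>z\<close> and \<open>x\<close>. In \<open>\<kappa>'\<close> the first summand
    pays for going from \<open>x\<close> to \<open>q\<close>, the second for going from
    \<open>q\<close> to \<open>p\<close>, and 1 covers the case answered by
    \<open>z\<close>.\<close>
  define R where "R = dist w z + 1 + \<kappa>"
  have R: "R > 0"
    using \<kappa>(1) by (simp add: R_def add_nonneg_pos)
  define \<kappa>' where "\<kappa>' = \<kappa> + (\<kappa> + 1) * R / \<epsilon> + 1"
  have \<kappa>'1: "\<kappa>' \<ge> 1"
    using \<kappa>(1) R \<epsilon>(1) by (simp add: \<kappa>'_def)
  have "\<exists>q\<in>A \<inter> S. dist x q \<le> \<kappa>' * dist x y"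
    if x: "x \<in> A" "dist x z \<le> 1" and y: "y \<in> S" for x y
  proof -
    consider "dist x y > 1" | "x = y" | "0 < dist x y" "dist x y \<le> 1"
      by fastforce
    then show ?thesis
    proof cases
      case 1
      then have "dist x z \<le> 1 * dist x y"
        using x(2) by simp
      also have "\<dots> \<le> \<kappa>' * dist x y"
        using \<kappa>'1 by (intro mult_right_mono) auto
      finally show ?thesis
        using z by blast
    next
      case 2
      then show ?thesis
        using x(1) y by auto
    next
      case 3
      define t where "t = dist x y"
      have t: "0 < t" "t \<le> 1"
        using 3 by (auto simp: t_def)
      obtain q where q: "q \<in> A" "q \<in> ?T" "dist x q \<le> \<kappa> * t"
        using \<kappa>(2)[OF x(1) _ x(2), of y] y ST unfolding t_def by blast
      define \<eta> where "\<eta> = (\<kappa> + 1) * t"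
      have \<eta>: "\<eta> > 0"
        using \<kappa>(1) t by (simp add: \<eta>_def)
      have qy: "dist q y \<le> \<eta>"
        using q(3) dist_triangle[of q y x] by (simp add: \<eta>_def t_def dist_commute algebra_simps)
      txt \<open>\<open>w'\<close> is chosen so that \<open>y\<close>-terms cancel in the combination \<open>p\<close> of \<open>w'\<close> and \<open>y\<close>,
        which is therefore also a combination of \<open>w\<close> and \<open>q\<close>.\<close>
      define w' where "w' = w + (\<epsilon> / \<eta>) *\<^sub>R (q - y)"
      have "w' \<in> cball w \<epsilon>"
      proof -
        have "\<epsilon> / \<eta> * norm (q - y) \<le> \<epsilon> / \<eta> * \<eta>"
          using qy \<epsilon>(1) \<eta> by (intro mult_left_mono) (auto simp: dist_norm)
        then have "norm ((\<epsilon> / \<eta>) *\<^sub>R (q - y)) \<le> \<epsilon>"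
          using \<epsilon>(1) \<eta> unfolding norm_scaleR by simp
        then show ?thesis
          by (simp add: w'_def dist_norm del: scaleR_diff_right)
      qed
      moreover have "w' \<in> ?T"
        unfolding w'_def
        by (rule affine_affine_hull[THEN mem_affine_3_minus]) (use wS y q(2) ST in auto)
      ultimately have w': "w' \<in> S"
        using \<epsilon>(2) by blast
      define p where "p = (\<eta> / (\<epsilon> + \<eta>)) *\<^sub>R w + (\<epsilon> / (\<epsilon> + \<eta>)) *\<^sub>R q"
      have one: "\<eta> / (\<epsilon> + \<eta>) + \<epsilon> / (\<epsilon> + \<eta>) = 1"
        using \<epsilon>(1) \<eta> by (simp add: add_divide_distrib[symmetric])
      have "p = (\<eta> / (\<epsilon> + \<eta>)) *\<^sub>R w' + (\<epsilon> / (\<epsilon> + \<eta>)) *\<^sub>R y"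
        using \<eta> by (simp add: p_def w'_def algebra_simps)
      also have "\<dots> \<in> S"
        by (intro convexD[OF S w' y _ _ one]) (use \<epsilon>(1) \<eta> in auto)
      finally have "p \<in> S" .
      moreover have "p \<in> A"
        unfolding p_def by (rule mem_affine[OF A w(2) q(1) one])
      moreover have "dist x p \<le> \<kappa>' * t"
      proof -
        have "dist w q \<le> R"
        proof -
          have "\<kappa> * t \<le> \<kappa>"
            using \<kappa>(1) t by simp
          then show ?thesis
            using dist_triangle[of w q z] dist_triangle[of z q x] x(2) q(3)
            by (simp add: R_def dist_commute)
        qed
        have "q - p = (\<eta> / (\<epsilon> + \<eta>)) *\<^sub>R (q - w)"
        proof -
          have "q = (\<eta> / (\<epsilon> + \<eta>)) *\<^sub>R q + (\<epsilon> / (\<epsilon> + \<eta>)) *\<^sub>R q"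
            by (simp only: scaleR_add_left[symmetric] one scaleR_one)
          then show ?thesis
            by (simp add: p_def algebra_simps)
        qed
        then have "dist q p = \<eta> / (\<epsilon> + \<eta>) * dist w q"
          using \<epsilon>(1) \<eta> by (simp add: dist_norm norm_minus_commute)
        also have "\<dots> \<le> \<eta> / \<epsilon> * R"
          by (intro mult_mono frac_le) (use \<epsilon>(1) \<eta> \<open>dist w q \<le> R\<close> in auto)
        also have "\<dots> = (\<kappa> + 1) * R / \<epsilon> * t"
          by (simp add: \<eta>_def)
        finally have "dist q p \<le> (\<kappa> + 1) * R / \<epsilon> * t" .
        then show ?thesis
          using dist_triangle[of x p q] q(3) t by (simp add: \<kappa>'_def algebra_simps)
      qed
      ultimately show ?thesis
        unfolding t_def by blast
    qed
  qed
  then show ?thesis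
    using that[of \<kappa>'] \<kappa>'1 by force
qed

section \<open>Error bounds and the KL property\<close>

text \<open>\<open>y\<close> minimizes \<open>F\<close> plus \<open>\<sigma> / 2\<close> times the
  squared distance to \<open>x0\<close>. Comparison with \<open>x0\<close> gives the descent
  inequality, and first-order optimality gives the subgradient.\<close>

lemma proximal_step:
  fixes F :: "'a::euclidean_space \<Rightarrow> ereal"
  assumes cl: "closed_fun F" and cv: "convex_fun F" and m: "\<And>x. ereal m \<le> F x"
    and x0: "F x0 \<le> ereal (m + d)" and d: "0 \<le> d" and \<sigma>: "\<sigma> > 0"
  obtains y s where "F y = ereal s" "s + \<sigma> / 2 * (dist y x0)\<^sup>2 \<le> m + d"
    "\<sigma> *\<^sub>R (x0 - y) \<in> subdifferential F y"
proof -
  \<comment> \<open>On the epigraph the objective is continuous, so closedness of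
    \<open>epi F\<close> replaces lower semicontinuity. Since heights are at least \<open>m\<close>,
    an objective value of at most \<open>m + d\<close> forces distance at most \<open>R\<close> from
    \<open>x0\<close>.\<close>
  define g :: "'a \<times> real \<Rightarrow> real" where "g p = snd p + \<sigma> / 2 * (dist (fst p) x0)\<^sup>2" for p
  define R where "R = sqrt (2 * d / \<sigma>)"
  define K where "K = epi F \<inter> (cball x0 R \<times> {m..m + d})"
  have "compact K"
    unfolding K_def using cl
    by (intro closed_Int_compact compact_Times compact_cball compact_Icc)
      (simp add: closed_fun_def)
  moreover have x0K: "(x0, m + d) \<in> K"
    using x0 d \<sigma> by (auto simp: K_def epi_def R_def)
  moreover have "continuous_on K g"
    unfolding g_def by (intro continuous_intros)
  ultimately obtain p where p: "p \<in> K" "\<And>p'. p' \<in> K \<Longrightarrow> g p \<le> g p'"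
    using continuous_attains_inf[of K g] by blast
  obtain y s where ps: "p = (y, s)"
    by fastforce
  have gp: "g p \<le> m + d"
    using p(2)[OF x0K] by (simp add: g_def)
  \<comment> \<open>Points of the epigraph outside \<open>K\<close> have objective above
    \<open>m + d\<close>, so minimality on \<open>K\<close> is global.\<close>
  have gmin: "g p \<le> g (z, t)" if "F z \<le> ereal t" for z t
  proof (cases "g (z, t) \<le> m + d")
    case True
    have mt: "m \<le> t"
      using m[of z] that order_trans ereal_less_eq(3) by blast
    have "0 \<le> \<sigma> / 2 * (dist z x0)\<^sup>2"
      using \<sigma> by simp
    then have "t \<le> m + d"
      using True unfolding g_def by simp
    moreover have "(dist z x0)\<^sup>2 \<le> 2 * d / \<sigma>"
      using True mt \<sigma> by (simp add: g_def field_simps)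
    then have "dist x0 z \<le> R"
      unfolding R_def by (metis dist_commute real_le_rsqrt)
    ultimately show ?thesis
      using p(2)[of "(z, t)"] that mt by (simp add: K_def epi_def)
  qed (use gp in simp)
  have Fy: "F y \<le> ereal s"
    using p(1) by (auto simp: K_def ps epi_def)
  obtain s' where s': "F y = ereal s'"
    using m[of y] Fy by (cases "F y") auto
  have "s \<le> s'"
    using gmin[of y s'] s' by (simp add: g_def ps)
  then have Fys: "F y = ereal s"
    using Fy s' by simp
  have "F y + ereal ((\<sigma> *\<^sub>R (x0 - y)) \<bullet> (z - y)) \<le> F z" for z
  proof (cases "F z")
    case (real t)
    define i where "i = (x0 - y) \<bullet> (z - y)"
    define e where "e = s + \<sigma> * i - t"
    define c where "c = \<sigma> / 2 * (norm (z - y))\<^sup>2"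
    \<comment> \<open>Moving from \<open>y\<close> a fraction \<open>l\<close> toward
      \<open>z\<close> changes the objective by at most \<open>l * (l * c - e)\<close>. Dividing by
      \<open>l\<close> and letting it tend to 0 yields \<open>e \<le> 0\<close>, the subgradient
      inequality.\<close>
    have key: "e \<le> l * c" if l: "0 < l" "l \<le> 1" for l
    proof -
      have "(1 - l) *\<^sub>R (y, s) + l *\<^sub>R (z, t) \<in> epi F"
        by (rule convexD[OF cv[unfolded convex_fun_def]]) (use l Fy real in \<open>auto simp: epi_def\<close>)
      then have "F (y + l *\<^sub>R (z - y)) \<le> ereal (s + l * (t - s))"
        by (simp add: epi_def algebra_simps)
      then have le: "g (y, s) \<le> g (y + l *\<^sub>R (z - y), s + l * (t - s))"
        using gmin ps by blast
      have sq: "(dist (y + l *\<^sub>R (z - y)) x0)\<^sup>2 =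
          (dist y x0)\<^sup>2 - 2 * l * i + l\<^sup>2 * (norm (z - y))\<^sup>2"
        unfolding dist_norm power2_norm_eq_inner power2_eq_square[of l] i_def
        by (simp add: inner_commute algebra_simps)
      have "0 \<le> l * (l * c - e)"
        using le unfolding g_def fst_conv snd_conv sq e_def c_def
        by (simp add: power2_eq_square[of l] algebra_simps)
      then show ?thesis
        using l by (simp add: zero_le_mult_iff)
    qed
    have "((\<lambda>l. l * c) \<longlongrightarrow> 0 * c) (at_right 0)"
      by (intro tendsto_intros)
    moreover have "eventually (\<lambda>l. e \<le> l * c) (at_right 0)"
      unfolding eventually_at_right_field using key by (intro exI[of _ 1]) auto
    ultimately have "e \<le> 0"
      using tendsto_lowerbound[of "\<lambda>l. l * c" "0 * c" "at_right 0" e] by simp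
    then show ?thesis
      by (simp add: Fys real e_def i_def)
  qed (use m[of z] in auto)
  then show ?thesis
    using that[of y s] Fys gp by (simp add: subdifferential_def g_def ps)
qed

lemma deriv_powr_scaled:
  fixes s :: real
  assumes "s > 0"
  shows "deriv (\<lambda>s. \<rho> * s powr (1 - \<alpha>)) s = \<rho> * (1 - \<alpha>) * s powr (- \<alpha>)"
  by (rule DERIV_imp_deriv) (use assms in \<open>auto intro!: derivative_eq_intros\<close>)

text \<open>The KL property keeps subgradients away from 0 at positive gap, so a proximal step
  halves a gap bound \<open>d\<close> at a cost of order \<open>d powr (1 - \<alpha>)\<close>. Under
  repeated halving these costs form a geometric series, whose sum bounds the distance to a
  minimizer.\<close>

lemma KL_property_error_bound:
  fixes F :: "'a::euclidean_space \<Rightarrow> ereal"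
  assumes cl: "closed_fun F" and cv: "convex_fun F" and m: "\<And>x. ereal m \<le> F x"
    and Fxb: "F xb = ereal m" and KL: "KL_property F \<alpha> xb" and \<alpha>: "0 \<le> \<alpha>" "\<alpha> < 1"
  obtains C \<delta> where "C > 0" "\<delta> > 0"
    "\<And>x d. \<lbrakk>dist x xb < \<delta>; 0 < d; d < \<delta>; F x \<le> ereal (m + d)\<rbrakk>
       \<Longrightarrow> \<exists>p. F p = ereal m \<and> dist x p \<le> C * d powr (1 - \<alpha>)"
proof -
  obtain r \<rho> U where r: "0 < r" and \<rho>: "0 < \<rho>" and U: "open U" "xb \<in> U"
    and KLU: "\<And>x. \<lbrakk>x \<in> U; F xb < F x; F x < F xb + r\<rbrakk> \<Longrightarrow>
      1 \<le> ereal (deriv (\<lambda>s. \<rho> * s powr (1 - \<alpha>)) (real_of_ereal (F x - F xb)))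
             * edist_set 0 (subdifferential F x)"
    using KL unfolding KL_property_def by blast
  obtain \<epsilon> where \<epsilon>: "\<epsilon> > 0" "ball xb \<epsilon> \<subseteq> U"
    using U open_contains_ball by blast
  \<comment> \<open>\<open>r\<close> may be infinite; a finite threshold is needed below.\<close>
  obtain r0 where r0: "r0 > 0" "ereal r0 \<le> r"
    using r ereal_dense2[OF r] by (metis ereal_less(2) less_imp_le)
  define K where "K = \<rho> * (1 - \<alpha>)"
  have K: "K > 0"
    using \<rho> \<alpha> by (simp add: K_def)
  have slope: "(s - m) powr \<alpha> \<le> K * norm v"
    if "dist y xb < \<epsilon>" "F y = ereal s" "m < s" "s < m + r0" "v \<in> subdifferential F y" for y s v
  proof -
    have "F y < F xb + ereal r0"
      using that Fxb by simp
    also have "\<dots> \<le> F xb + r"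
      using r0(2) by (rule add_left_mono)
    finally have "1 \<le> ereal (K * (s - m) powr (- \<alpha>)) * edist_set 0 (subdifferential F y)"
      using KLU[of y] that \<epsilon>(2) Fxb by (auto simp: dist_commute deriv_powr_scaled K_def)
    also have "\<dots> \<le> ereal (K * (s - m) powr (- \<alpha>)) * ereal (norm v)"
    proof (rule ereal_mult_left_mono)
      show "edist_set 0 (subdifferential F y) \<le> ereal (norm v)"
        unfolding edist_set_def using that(5) by (intro INF_lower2[of v]) auto
    qed (use K in simp)
    finally show ?thesis
      using that(3) by (simp add: powr_minus field_simps)
  qed
  \<comment> \<open>A proximal step has length at most \<open>2 * (K * d / e)\<close> with
    \<open>e = (d / 2) powr \<alpha>\<close>, and \<open>d / e\<close> contributes another factor
    2.\<close>
  define C where "C = 4 * K"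
  have C: "C > 0"
    using K by (simp add: C_def)
  have halve: "\<exists>y'. F y' \<le> ereal (m + d / 2) \<and> dist y' y \<le> C * d powr (1 - \<alpha>)"
    if y: "dist y xb < \<epsilon> / 2" "F y \<le> ereal (m + d)"
      and d: "0 < d" "d < r0" "C * d powr (1 - \<alpha>) < \<epsilon> / 2" for y d
  proof -
    define e where "e = (d / 2) powr \<alpha>"
    have e: "e > 0"
      using d by (simp add: e_def)
    txt \<open>The largest \<open>\<sigma>\<close> for which a gap above \<open>d / 2\<close> after the proximal step contradicts
      \<open>slope\<close>.\<close>
    define \<sigma> where "\<sigma> = e\<^sup>2 / (K\<^sup>2 * d)"
    have \<sigma>: "\<sigma> > 0"
      using e K d by (simp add: \<sigma>_def)
    obtain y' s where y': "F y' = ereal s" "s + \<sigma> / 2 * (dist y' y)\<^sup>2 \<le> m + d"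
      "\<sigma> *\<^sub>R (y - y') \<in> subdifferential F y'"
      using proximal_step[OF cl cv m y(2) _ \<sigma>] d by auto
    have ms: "m \<le> s"
      using m[of y'] y'(1) by simp
    have dist: "dist y' y \<le> C * d powr (1 - \<alpha>)"
    proof -
      have "(dist y' y)\<^sup>2 \<le> 2 * d / \<sigma>"
        using y'(2) ms \<sigma> by (simp add: field_simps)
      also have "\<dots> = 2 * (K * d / e)\<^sup>2"
        using e K d by (simp add: \<sigma>_def power2_eq_square)
      also have "\<dots> \<le> (2 * (K * d / e))\<^sup>2"
        using zero_le_power2[of "K * d / e"] unfolding power_mult_distrib by simp
      finally have "dist y' y \<le> 2 * (K * d / e)"
        by (rule power2_le_imp_le) (use K d e in auto)
      also have "d / e = 2 * (d / 2) powr (1 - \<alpha>)"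
        using d by (simp add: e_def powr_diff)
      then have "2 * (K * d / e) = C * (d / 2) powr (1 - \<alpha>)"
        by (simp add: C_def flip: times_divide_eq_right)
      also have "\<dots> \<le> C * d powr (1 - \<alpha>)"
        using C d \<alpha> by (intro mult_left_mono powr_mono2) auto
      finally show ?thesis .
    qed
    have "s \<le> m + d / 2"
    proof (rule ccontr)
      assume "\<not> ?thesis"
      then have s: "s > m + d / 2"
        by simp
      have near: "dist y' xb < \<epsilon>"
        using dist_triangle[of y' xb y] dist y(1) d(3) by simp
      have "0 \<le> \<sigma> / 2 * (dist y' y)\<^sup>2"
        using \<sigma> by simp
      then have "s < m + r0"
        using y'(2) d(2) by linarith
      then have "(s - m) powr \<alpha> \<le> K * (\<sigma> * dist y' y)"
        using slope[OF near y'(1) _ _ y'(3)] s d \<sigma> by (simp add: dist_norm norm_minus_commute)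
      moreover have "e \<le> (s - m) powr \<alpha>"
        unfolding e_def using s d \<alpha> by (intro powr_mono2) auto
      ultimately have "e\<^sup>2 \<le> (K * (\<sigma> * dist y' y))\<^sup>2"
        using e by (intro power_mono) auto
      also have "\<dots> = K\<^sup>2 * \<sigma> * (\<sigma> * (dist y' y)\<^sup>2)"
        by (simp add: power2_eq_square)
      \<comment> \<open>A remaining gap above \<open>d / 2\<close> leaves less than
        \<open>d / 2\<close> for the quadratic term of the descent inequality.\<close>
      also have "\<dots> < K\<^sup>2 * \<sigma> * d"
        using y'(2) s K \<sigma> by (intro mult_strict_left_mono) auto
      also have "\<dots> = e\<^sup>2"
        using K d by (simp add: \<sigma>_def)
      finally show False
        by simp
    qed
    then show ?thesis
      using y'(1) dist by (intro exI[of _ y']) simp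
  qed
  \<comment> \<open>Halving a gap multiplies its power by \<open>\<theta>\<close>. As
    \<open>C' * (1 - \<theta>) = 2 * C\<close>, the drop in the power, weighted by
    \<open>C'\<close>, exceeds the distance travelled.\<close>
  define \<theta> where "\<theta> = (1/2::real) powr (1 - \<alpha>)"
  have \<theta>: "0 < \<theta>" "\<theta> < 1"
    using \<alpha> powr_less_mono2[of "1 - \<alpha>" "1/2" 1] by (auto simp: \<theta>_def)
  define C' where "C' = 2 * C / (1 - \<theta>)"
  have C': "C < C' * (1 - \<theta>)" "C < C'"
    using C \<theta> by (auto simp: C'_def field_simps intro!: add_pos_pos mult_pos_pos)
  \<comment> \<open>The power term gives \<open>C' * d powr (1 - \<alpha>) < \<epsilon> / 4\<close>,
    so the search around \<open>x\<close> stays within \<open>\<epsilon> / 2\<close> of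
    \<open>xb\<close>, where \<open>halve\<close> applies.\<close>
  define \<delta> where "\<delta> = min r0 (min (\<epsilon> / 4) ((\<epsilon> / (4 * C')) powr (1 / (1 - \<alpha>))))"
  have \<delta>: "\<delta> > 0"
    using r0 \<epsilon> C C' by (simp add: \<delta>_def)
  have "\<exists>p. F p = ereal m \<and> dist x p \<le> C' * d powr (1 - \<alpha>)"
    if x: "dist x xb < \<delta>" "F x \<le> ereal (m + d)" and d: "0 < d" "d < \<delta>" for x d
  proof -
    define R where "R = C' * d powr (1 - \<alpha>)"
    have R: "R < \<epsilon> / 4"
    proof -
      have "d powr (1 - \<alpha>) < ((\<epsilon> / (4 * C')) powr (1 / (1 - \<alpha>))) powr (1 - \<alpha>)"
        using d \<alpha> by (intro powr_less_mono2) (auto simp: \<delta>_def)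
      also have "\<dots> = \<epsilon> / (4 * C')"
        using \<alpha> \<epsilon> C C' by (simp add: powr_powr)
      finally show ?thesis
        using C C' by (simp add: R_def field_simps)
    qed
    txt \<open>Ekeland's principle by compactness: by \<open>halve\<close>, a minimizer of \<open>g\<close> has zero gap.\<close>
    define g :: "'a \<times> real \<Rightarrow> real"
      where "g p = C' * (snd p - m) powr (1 - \<alpha>) + dist (fst p) x" for p
    define A where "A = epi F \<inter> (cball x R \<times> {m..m + d})"
    have "compact A"
      unfolding A_def using cl
      by (intro closed_Int_compact compact_Times compact_cball compact_Icc)
        (simp add: closed_fun_def)
    moreover have xA: "(x, m + d) \<in> A"
      using x d C C' by (auto simp: A_def epi_def R_def)
    \<comment> \<open>On \<open>A\<close> the base of the power is nonnegative and the exponent is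
      positive, so continuity extends to gap 0.\<close>
    moreover have "continuous_on A g"
      unfolding g_def using \<alpha>
      by (intro continuous_on_add continuous_on_mult continuous_on_powr' continuous_on_diff
          continuous_on_dist continuous_on_fst continuous_on_snd continuous_on_const continuous_on_id)
        (auto simp: A_def)
    ultimately obtain p where p: "p \<in> A" "\<And>p'. p' \<in> A \<Longrightarrow> g p \<le> g p'"
      using continuous_attains_inf[of A g] by blast
    obtain y s where ps: "p = (y, s)"
      by fastforce
    have y: "F y \<le> ereal s" "dist y x \<le> R" "m \<le> s" "s \<le> m + d"
      using p(1) by (auto simp: A_def epi_def ps dist_commute)
    have gp: "g p \<le> R"
      using p(2)[OF xA] by (simp add: g_def R_def)
    have "s = m"
    proof (rule ccontr)
      assume "s \<noteq> m"
      define c where "c = s - m"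
      have c: "0 < c" "c \<le> d" "s = m + c"
        using y \<open>s \<noteq> m\<close> by (auto simp: c_def)
      have "C * c powr (1 - \<alpha>) \<le> R"
        unfolding R_def using c C C' \<alpha> by (intro mult_mono powr_mono2) auto
      moreover have "dist y xb < \<epsilon> / 2"
        using dist_triangle[of y xb x] y(2) R x(1) by (simp add: \<delta>_def)
      ultimately obtain y' where
        y': "F y' \<le> ereal (m + c / 2)" "dist y' y \<le> C * c powr (1 - \<alpha>)"
        using halve[of y c] y(1) c d R \<epsilon>(1) by (auto simp: \<delta>_def)
      have "g (y', m + c / 2) \<le> C' * (\<theta> * c powr (1 - \<alpha>)) + (C * c powr (1 - \<alpha>) + dist y x)"
        using dist_triangle[of y' x y] y'(2) c powr_mult[of "1/2" c "1 - \<alpha>"]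
        by (simp add: g_def \<theta>_def)
      also have "\<dots> < C' * (\<theta> * c powr (1 - \<alpha>)) + (C' * (1 - \<theta>) * c powr (1 - \<alpha>) + dist y x)"
        using C'(1) c by simp
      also have "\<dots> = g p"
        by (simp add: g_def ps c_def algebra_simps)
      finally have less: "g (y', m + c / 2) < g p" .
      moreover have "dist y' x \<le> g (y', m + c / 2)"
        using C C' by (simp add: g_def)
      ultimately have "(y', m + c / 2) \<in> A"
        using gp y'(1) c by (simp add: A_def epi_def dist_commute)
      then show False
        using p(2) less by fastforce
    qed
    then show ?thesis
      using y m[of y] unfolding R_def by (metis dist_commute order_antisym)
  qed
  then show ?thesis
    using that[of C' \<delta>] \<delta> C C' by (meson less_trans)
qed

text \<open>Testing a subgradient \<open>v\<close> at \<open>x\<close> against the nearby minimizer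
  \<open>p\<close> gives \<open>d \<le> norm v * (C * d powr (1 - \<alpha>))\<close>, a lower bound
  on \<open>norm v\<close> of order \<open>d powr \<alpha>\<close>.\<close>

lemma error_bound_KL_property:
  fixes F :: "'a::real_inner \<Rightarrow> ereal"
  assumes m: "\<And>x. ereal m \<le> F x" and Fxb: "F xb = ereal m" and \<alpha>: "\<alpha> < 1"
    and C: "C > 0" and \<delta>: "\<delta> > 0"
    and err: "\<And>x d. \<lbrakk>dist x xb < \<delta>; 0 < d; d < \<delta>; F x = ereal (m + d)\<rbrakk>
       \<Longrightarrow> \<exists>p. F p = ereal m \<and> dist x p \<le> C * d powr (1 - \<alpha>)"
  shows "KL_property F \<alpha> xb"
  unfolding KL_property_def
proof (intro conjI exI ballI impI)
  have "0 \<in> subdifferential F xb"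
    using m Fxb by (simp add: subdifferential_def)
  then show "xb \<in> dom_subdifferential F"
    by (auto simp: dom_subdifferential_def)
  \<comment> \<open>Dividing \<open>C\<close> by \<open>1 - \<alpha>\<close> cancels the factor
    produced by differentiation.\<close>
  show "0 < ereal \<delta>" "0 < C / (1 - \<alpha>)" "open (ball xb \<delta>)" "xb \<in> ball xb \<delta>"
    using \<delta> C \<alpha> by auto
  fix x
  assume x: "x \<in> ball xb \<delta>" and less: "F xb < F x \<and> F x < F xb + ereal \<delta>"
  then obtain d where d: "F x = ereal (m + d)" "0 < d" "d < \<delta>"
  proof (cases "F x")
    case (real t)
    then show ?thesis
      using that[of "t - m"] less Fxb by simp
  qed (use Fxb in auto)
  obtain p where p: "F p = ereal m" "dist x p \<le> C * d powr (1 - \<alpha>)"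
    using err[of x d] x d by (auto simp: dist_commute)
  define k where "k = C * d powr (- \<alpha>)"
  have k: "k > 0"
    using C d by (simp add: k_def)
  have "ereal (1 / k) \<le> edist_set 0 (subdifferential F x)"
    unfolding edist_set_def
  proof (rule INF_greatest)
    fix v assume "v \<in> subdifferential F x"
    then have "F x + ereal (v \<bullet> (p - x)) \<le> F p"
      by (simp add: subdifferential_def)
    then have "d \<le> v \<bullet> (x - p)"
      by (simp add: d p inner_diff_right)
    also have "\<dots> \<le> norm v * dist x p"
      unfolding dist_norm by (rule norm_cauchy_schwarz)
    also have "\<dots> \<le> norm v * (C * d powr (1 - \<alpha>))"
      using p(2) by (intro mult_left_mono) auto
    also have "\<dots> = norm v * k * d"
      using d powr_add[of d "- \<alpha>" 1] by (simp add: k_def)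
    finally have "1 \<le> norm v * k"
      using d by simp
    then show "ereal (1 / k) \<le> ereal (dist 0 v)"
      using k by (simp add: field_simps)
  qed
  then have "ereal k * ereal (1 / k) \<le> ereal k * edist_set 0 (subdifferential F x)"
    by (rule ereal_mult_left_mono) (use k in simp)
  moreover have "ereal k * ereal (1 / k) = 1"
    using k by simp
  ultimately have "1 \<le> ereal k * edist_set 0 (subdifferential F x)"
    by (simp only:)
  moreover have "deriv (\<lambda>s. C / (1 - \<alpha>) * s powr (1 - \<alpha>)) (real_of_ereal (F x - F xb)) = k"
    using d Fxb \<alpha> deriv_powr_scaled[of d "C / (1 - \<alpha>)" \<alpha>] by (simp add: k_def)
  ultimately show "1 \<le> ereal (deriv (\<lambda>s. C / (1 - \<alpha>) * s powr (1 - \<alpha>)) (real_of_ereal (F x - F xb)))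
             * edist_set 0 (subdifferential F x)"
    by (simp only:)
qed

section \<open>The Lagrangian\<close>

text \<open>Adding a real affine function shears the epigraph; closedness and convexity pass through
  this preimage.\<close>

lemma epi_lagrangian:
  "epi (lagrangian h G b l) = (\<lambda>(x, r). (x, r - l \<bullet> (G x - b))) -` epi h"
proof -
  have "lagrangian h G b l x \<le> ereal r \<longleftrightarrow> h x \<le> ereal (r - l \<bullet> (G x - b))" for x r
    by (cases "h x") (auto simp: lagrangian_def)
  then show ?thesis
    by (auto simp: epi_def)
qed

lemma closed_fun_lagrangian:
  fixes G :: "'a::euclidean_space \<Rightarrow> 'b::euclidean_space"
  assumes "closed_fun h" "linear G"
  shows "closed_fun (lagrangian h G b l)"
proof -
  have "continuous_on UNIV G"
    using assms(2) by (intro linear_continuous_on linear_conv_bounded_linear[THEN iffD1])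
  then have "continuous_on UNIV (\<lambda>p :: 'a \<times> real. G (fst p))"
    by (rule continuous_on_compose2) (intro continuous_on_fst continuous_on_id, simp)
  then show ?thesis
    unfolding closed_fun_def epi_lagrangian case_prod_unfold
    by (intro closed_vimage[OF assms(1)[unfolded closed_fun_def]] continuous_intros)
qed

lemma convex_fun_lagrangian:
  fixes G :: "'a::real_vector \<Rightarrow> 'b::real_inner"
  assumes "convex_fun h" "linear G"
  shows "convex_fun (lagrangian h G b l)"
  unfolding convex_fun_def
proof (rule convexI)
  interpret linear G by fact
  fix p q :: "'a \<times> real" and u v :: real
  assume p: "p \<in> epi (lagrangian h G b l)" and q: "q \<in> epi (lagrangian h G b l)"
    and uv: "0 \<le> u" "0 \<le> v" "u + v = 1"
  define \<Phi> where "\<Phi> p = (fst p, snd p - l \<bullet> (G (fst p) - b))" for p :: "'a \<times> real"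
  have epi: "p \<in> epi (lagrangian h G b l) \<longleftrightarrow> \<Phi> p \<in> epi h" for p
    by (simp add: epi_lagrangian \<Phi>_def case_prod_unfold)
  have u: "u = 1 - v"
    using uv(3) by simp
  have "G (fst (u *\<^sub>R p + v *\<^sub>R q)) - b = u *\<^sub>R (G (fst p) - b) + v *\<^sub>R (G (fst q) - b)"
    unfolding u fst_add fst_scaleR add scale by (simp add: scaleR_diff_left scaleR_diff_right)
  then have "\<Phi> (u *\<^sub>R p + v *\<^sub>R q) = u *\<^sub>R \<Phi> p + v *\<^sub>R \<Phi> q"
    unfolding \<Phi>_def by (simp add: inner_add_right right_diff_distrib)
  moreover have "u *\<^sub>R \<Phi> p + v *\<^sub>R \<Phi> q \<in> epi h"
    using assms(1) p q uv unfolding epi convex_fun_def by (rule convexD)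
  ultimately show "u *\<^sub>R p + v *\<^sub>R q \<in> epi (lagrangian h G b l)"
    using epi by simp
qed

text \<open>Two minimizers admit the same heights in the convex epigraph. Testing every real height
  also covers infinite values.\<close>

lemma convex_Argmin:
  fixes F :: "'a::real_vector \<Rightarrow> ereal"
  assumes "convex_fun F"
  shows "convex (Argmin F)"
proof (rule convexI)
  fix p q :: 'a and u v :: real
  assume p: "p \<in> Argmin F" and q: "q \<in> Argmin F" and uv: "0 \<le> u" "0 \<le> v" "u + v = 1"
  have F_eq: "F q = F p"
    using p q by (simp add: Argmin_def antisym)
  have "F (u *\<^sub>R p + v *\<^sub>R q) \<le> ereal r" if "F p \<le> ereal r" for r
  proof -
    have "u *\<^sub>R (p, r) + v *\<^sub>R (q, r) \<in> epi F"
      by (rule convexD[OF assms[unfolded convex_fun_def]])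
        (use that uv F_eq in \<open>auto simp: epi_def\<close>)
    then show ?thesis
      using uv(3) by (simp add: epi_def flip: distrib_right)
  qed
  then have "F (u *\<^sub>R p + v *\<^sub>R q) \<le> F p"
    by (rule ereal_le_real)
  then show "u *\<^sub>R p + v *\<^sub>R q \<in> Argmin F"
    using p by (auto simp: Argmin_def intro: order_trans)
qed

theorem theorem4p6:
  fixes h :: "'a::euclidean_space \<Rightarrow> ereal"
    and G :: "'a \<Rightarrow> 'b::euclidean_space"
    and b l :: 'b
    and xb :: 'a
    and \<alpha> :: real
  assumes "proper_fun h" and "closed_fun h" and "convex_fun h"
    and "linear G"
    and "b \<in> G ` eff_dom h"
    and "Argmin (constrained_obj h G b) \<noteq> {}"
    and "lagrange_multiplier h G b l"
    and "0 \<le> \<alpha>" and "\<alpha> < 1"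
    and "xb \<in> Argmin (constrained_obj h G b)"
    and "KL_property (lagrangian h G b l) \<alpha> xb"
    and "rel_interior (Argmin (lagrangian h G b l)) \<inter> G -` {b} \<noteq> {} \<or>
         polyhedron (Argmin (lagrangian h G b l))"
  shows "KL_property (constrained_obj h G b) \<alpha> xb"
proof -
  let ?F = "lagrangian h G b l" and ?H = "constrained_obj h G b" and ?A = "G -` {b}"
  interpret G: linear G by fact
  have H_feas: "?H x = h x" if "G x = b" for x
    using that by (simp add: constrained_obj_def indicator_fun_def)
  have F_feas: "?F x = h x" if "G x = b" for x
    using that by (simp add: lagrangian_def flip: zero_ereal_def)
  have h_ninf: "h x \<noteq> -\<infinity>" for x
    using assms(1) by (simp add: proper_fun_def)
  have H_infeas: "?H x = \<infinity>" if "G x \<noteq> b" for x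
    using that h_ninf by (simp add: constrained_obj_def indicator_fun_def)
  have xb_min: "?H xb \<le> ?H y" for y
    using assms(10) by (simp add: Argmin_def)
  obtain x0 where x0: "h x0 < \<infinity>" "G x0 = b"
    using assms(5) by (auto simp: eff_dom_def)
  have "?H xb < \<infinity>"
    using le_less_trans[OF xb_min[of x0], of \<infinity>] x0 H_feas[of x0] by simp
  then have Gxb: "G xb = b" and "h xb \<noteq> \<infinity>"
    using H_infeas[of xb] H_feas[of xb] by fastforce+
  then obtain m where hxb: "h xb = ereal m"
    using h_ninf[of xb] by (cases "h xb") auto
  \<comment> \<open>The constrained value is attained at \<open>xb\<close>; the multiplier condition
    then makes \<open>m\<close> the minimum of \<open>?F\<close> as well.\<close>
  have "(INF x\<in>{x. G x = b}. h x) = ereal m"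
  proof (rule antisym)
    show "(INF x\<in>{x. G x = b}. h x) \<le> ereal m"
      using Gxb hxb by (intro INF_lower2[of xb]) auto
    show "ereal m \<le> (INF x\<in>{x. G x = b}. h x)"
      using xb_min H_feas Gxb hxb by (intro INF_greatest) (metis mem_Collect_eq)
  qed
  then have "(INF x. ?F x) = ereal m"
    using assms(7) by (simp add: lagrange_multiplier_def)
  then have F_ge: "ereal m \<le> ?F x" for x
    by (metis INF_lower UNIV_I)
  have Fxb: "?F xb = ereal m"
    using F_feas Gxb hxb by simp
  have H_ge: "ereal m \<le> ?H x" for x
    using xb_min[of x] H_feas[OF Gxb] hxb by simp
  have S_iff: "p \<in> Argmin ?F \<longleftrightarrow> ?F p = ereal m" for p
    unfolding Argmin_def using F_ge Fxb by (auto intro: antisym) (metis antisym)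
  have F_closed: "closed_fun ?F" and F_convex: "convex_fun ?F"
    using assms(2-4) closed_fun_lagrangian convex_fun_lagrangian by blast+
  obtain C \<delta> where C: "C > 0" and \<delta>: "\<delta> > 0"
    and err: "\<And>x d. \<lbrakk>dist x xb < \<delta>; 0 < d; d < \<delta>; ?F x \<le> ereal (m + d)\<rbrakk>
       \<Longrightarrow> \<exists>p. ?F p = ereal m \<and> dist x p \<le> C * d powr (1 - \<alpha>)"
    using KL_property_error_bound[OF F_closed F_convex F_ge Fxb assms(11,8,9)] by metis
  have A: "affine ?A"
    unfolding affine_def by (auto simp: G.add G.scale simp flip: scaleR_add_left)
  have xb_mem: "xb \<in> ?A" "xb \<in> Argmin ?F"
    using Gxb S_iff Fxb by auto
  obtain \<kappa> where \<kappa>: "\<kappa> > 0"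
    "\<And>x y. \<lbrakk>x \<in> ?A; y \<in> Argmin ?F; dist x xb \<le> 1\<rbrakk>
      \<Longrightarrow> \<exists>q\<in>?A \<inter> Argmin ?F. dist x q \<le> \<kappa> * dist x y"
    using assms(12)
  proof
    assume "rel_interior (Argmin ?F) \<inter> ?A \<noteq> {}"
    then obtain w where "w \<in> rel_interior (Argmin ?F)" "w \<in> ?A"
      by blast
    then show ?thesis
      using rel_interior_linearly_regular[OF convex_Argmin[OF F_convex] A _ _ xb_mem(2,1)] that
      by metis
  next
    assume "polyhedron (Argmin ?F)"
    then show ?thesis
      using polyhedra_linearly_regular[OF affine_imp_polyhedron[OF A] _ xb_mem] that by metis
  qed
  show ?thesis
  proof (rule error_bound_KL_property[OF H_ge _ assms(9)])
    show "?H xb = ereal m"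
      using H_feas Gxb hxb by simp
    \<comment> \<open>The bound 1 is the radius within which linear regularity is available.\<close>
    show "\<kappa> * C > 0" "min \<delta> 1 > 0"
      using \<kappa>(1) C \<delta> by auto
    fix x d
    assume x: "dist x xb < min \<delta> 1" and d: "0 < d" "d < min \<delta> 1" "?H x = ereal (m + d)"
    have Gx: "G x = b"
      using H_infeas[of x] d(3) by fastforce
    then have "?F x \<le> ereal (m + d)"
      using d(3) F_feas H_feas by simp
    then obtain p where p: "?F p = ereal m" "dist x p \<le> C * d powr (1 - \<alpha>)"
      using err[of x d] x d by auto
    \<comment> \<open>\<open>p\<close> need not be feasible; regularity trades it for a feasible
      minimizer at the cost of a factor \<open>\<kappa>\<close>.\<close>
    obtain q where q: "q \<in> ?A" "q \<in> Argmin ?F" "dist x q \<le> \<kappa> * dist x p"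
      using \<kappa>(2)[of x p] Gx p(1) S_iff x by auto
    have "?H q = ereal m"
      using q S_iff F_feas H_feas by auto
    moreover have "dist x q \<le> \<kappa> * C * d powr (1 - \<alpha>)"
      using order_trans[OF q(3) mult_left_mono[OF p(2), of \<kappa>]] \<kappa>(1) by (simp add: mult.assoc)
    ultimately show "\<exists>p. ?H p = ereal m \<and> dist x p \<le> \<kappa> * C * d powr (1 - \<alpha>)"
      by blast
  qed
qed

end
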